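(* For any given robber speed $R>2$ (an integer, or $R=\infty$), the following hold for all sufficiently large $n$. (i) If $R<\infty$, there exists a connected $n$-vertex graph on which at least $n^{1-\frac{1}{R-2}}$ cops are required to catch a robber of speed $R$. (ii) If $R=\infty$, there exists a connected $n$-vertex graph on which at least $\frac{n}{800^2}$ cops are required to catch a robber of speed $R=\infty$.
   Context: Graphs are finite and undirected. Cops and Robbers with a robber of speed $R$ on a graph $G$: a perfect information game between a set of cops and one robber. First the cops are placed on vertices of their choice (several cops may share a vertex); then the robber, knowing the cops' placement, chooses a vertex. Then the cops and the robber move in alternate rounds, the cops moving first. In a cops' move each cop stays put or moves along one edge. In the robber's move he may traverse any walk of at most $R$ edges starting at his current position (any finite walk if $R=\infty$; possibly staying put), but he is not allowed to pass through (or end at) any vertex occupied by a cop. The cops win if eventually a cop steps onto the vertex currently occupied by the robber; the robber wins if he can elude the cops indefinitely. "At least $x$ cops are required" means that no number of cops smaller than $x$ has a winning strategy. *)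

theory Defs
  imports
    Complex_Main
    "HOL-Library.Extended_Nat"
    "Graph_Theory.Digraph_Component"
    "Graph_Theory.Vertex_Walk"
begin

text \<open>
  An undirected graph is a symmetric digraph (locale \<open>graph\<close>). The \<open>k\<close> cops are numbered
  \<open>0, \<dots>, k - 1\<close>, so a position of the cops is a function on \<open>{..<k}\<close>, not necessarily injective.
\<close>

definition cops_move :: "('a, 'b) pre_digraph \<Rightarrow> nat \<Rightarrow> (nat \<Rightarrow> 'a) \<Rightarrow> (nat \<Rightarrow> 'a) \<Rightarrow> bool" where
  "cops_move G k c c' \<longleftrightarrow> (\<forall>i<k. c' i = c i \<or> c i \<rightarrow>\<^bsub>G\<^esub> c' i)"

text \<open>
  \<open>C\<close> is the set of vertices occupied by cops. The start of the walk is exempt from the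
  test against \<open>C\<close>: a robber whose current vertex lies in \<open>C\<close> has just been caught, so the exemption
  only lets a decided play be continued (by staying put), so that all plays can be taken to be
  infinite.
\<close>

definition robber_move ::
    "('a, 'b) pre_digraph \<Rightarrow> enat \<Rightarrow> 'a set \<Rightarrow> 'a \<Rightarrow> 'a \<Rightarrow> bool" where
  "robber_move G R C v v' \<longleftrightarrow>
     (\<exists>w. vwalk w G \<and> hd w = v \<and> last w = v' \<and> enat (vwalk_length w) \<le> R \<and> set (tl w) \<inter> C = {})"

text \<open>
  A strategy of the cops maps the list of robber positions seen so far to the next position of the
  cops, so \<open>\<sigma> []\<close> is the initial placement. The cops' own past positions are determined
  by \<open>\<sigma>\<close> and the robber's past, so this is full perfect-information history dependence.

  If \<open>r t\<close> is the robber's position after \<open>t\<close> rounds, then \<open>cops_at \<sigma> r t\<close> is the cops' position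
  after \<open>t\<close> moves. Round \<open>t\<close> consists of the cops' move to \<open>cops_at \<sigma> r (Suc t)\<close>, while the robber
  is at \<open>r t\<close>, and the robber's move to \<open>r (Suc t)\<close>.
\<close>

type_synonym 'a cop_strategy = "'a list \<Rightarrow> nat \<Rightarrow> 'a"

definition cops_at :: "'a cop_strategy \<Rightarrow> (nat \<Rightarrow> 'a) \<Rightarrow> nat \<Rightarrow> nat \<Rightarrow> 'a" where
  "cops_at \<sigma> r t = \<sigma> (map r [0..<t])"

definition robber_play ::
    "('a, 'b) pre_digraph \<Rightarrow> enat \<Rightarrow> nat \<Rightarrow> 'a cop_strategy \<Rightarrow> (nat \<Rightarrow> 'a) \<Rightarrow> bool" where
  "robber_play G R k \<sigma> r \<longleftrightarrow>
     r 0 \<in> verts G \<and>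
     (\<forall>t. robber_move G R (cops_at \<sigma> r (Suc t) ` {..<k}) (r t) (r (Suc t)))"

definition legal_cop_strategy ::
    "('a, 'b) pre_digraph \<Rightarrow> enat \<Rightarrow> nat \<Rightarrow> 'a cop_strategy \<Rightarrow> bool" where
  "legal_cop_strategy G R k \<sigma> \<longleftrightarrow>
     (\<forall>i<k. \<sigma> [] i \<in> verts G) \<and>
     (\<forall>r. robber_play G R k \<sigma> r \<longrightarrow>
        (\<forall>t. cops_move G k (cops_at \<sigma> r t) (cops_at \<sigma> r (Suc t))))"

definition caught :: "nat \<Rightarrow> 'a cop_strategy \<Rightarrow> (nat \<Rightarrow> 'a) \<Rightarrow> bool" where
  "caught k \<sigma> r \<longleftrightarrow> (\<exists>t. \<exists>i<k. cops_at \<sigma> r (Suc t) i = r t)"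

definition cops_win :: "('a, 'b) pre_digraph \<Rightarrow> enat \<Rightarrow> nat \<Rightarrow> bool" where
  "cops_win G R k \<longleftrightarrow>
     (\<exists>\<sigma>. legal_cop_strategy G R k \<sigma> \<and> (\<forall>r. robber_play G R k \<sigma> r \<longrightarrow> caught k \<sigma> r))"

definition at_least_cops_required :: "('a, 'b) pre_digraph \<Rightarrow> enat \<Rightarrow> real \<Rightarrow> bool" where
  "at_least_cops_required G R x \<longleftrightarrow> (\<forall>k::nat. real k < x \<longrightarrow> \<not> cops_win G R k)"

end

theory Submission
  imports Defs "HOL-Combinatorics.Permutations" "HOL-Real_Asymp.Real_Asymp"
begin

text \<open>
  The graph is a path together with \<open>24 g\<close> random permutations. In it every set of at least
  \<open>n / (4 g)\<close> vertices meets or is adjacent to every set of at least \<open>n / 4\<close> vertices. Suppose that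
  \<open>S\<close>, the closed neighbourhood of the cops, has at most \<open>n / 8\<close> vertices. Deleting \<open>S\<close> and a
  maximal small set that does not expand by the factor \<open>g\<close> outside \<open>S\<close> leaves a territory of more
  than \<open>n / 2\<close> vertices in which every small set expands by the factor \<open>g\<close>, so balls
  of radius \<open>r + 1\<close> contain more than \<open>n / 2\<close> vertices once \<open>g ^ r \<ge> n / (4 g)\<close>. The robber stands
  in the territory of the current cops' position. The cops' next move cannot enter that territory,
  and his ball in it meets the territory of their new position, so he moves there. For \<open>R = \<infinity>\<close> a
  constant \<open>g\<close> suffices; for finite \<open>R\<close> one takes \<open>g\<close> about \<open>n powr (1 / (R - 1))\<close>, which beats the
  claimed exponent by a power of \<open>n\<close>.
\<close>

section \<open>From the game to territories of cop positions\<close>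

text \<open>A positional strategy suffices for the robber: he keeps the invariant that he stands in
  \<open>A\<close> of the current cop position. By \<open>safe\<close> the next cop move cannot
  catch him, and \<open>escape\<close> restores the invariant.\<close>

lemma not_cops_winI:
  fixes G :: "('a, 'b) pre_digraph" and A :: "(nat \<Rightarrow> 'a) \<Rightarrow> 'a set"
  assumes nonempty: "\<And>c. A c \<noteq> {}"
    and verts: "\<And>c. A c \<subseteq> verts G"
    and safe: "\<And>c c' v i. v \<in> A c \<Longrightarrow> cops_move G k c c' \<Longrightarrow> i < k \<Longrightarrow> c' i \<noteq> v"
    and escape: "\<And>c c' v. v \<in> A c \<Longrightarrow> cops_move G k c c' \<Longrightarrow>
      \<exists>v'\<in>A c'. robber_move G R (c' ` {..<k}) v v'"
  shows "\<not> cops_win G R k"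
proof
  assume "cops_win G R k"
  then obtain \<sigma> where legal: "legal_cop_strategy G R k \<sigma>"
    and win: "\<And>r. robber_play G R k \<sigma> r \<Longrightarrow> caught k \<sigma> r"
    unfolding cops_win_def by blast
  \<comment> \<open>Legality of a strategy is only assumed along infinite plays, so the robber stays put when he
    has no good reply: this makes \<open>r\<close> a play before legality is used.\<close>
  define ok where "ok h v \<longleftrightarrow> v \<in> A (\<sigma> h) \<and> robber_move G R (\<sigma> h ` {..<k}) (last h) v" for h v
  define nxt where "nxt h = (if \<exists>v. ok h v then SOME v. ok h v else last h)" for h
  obtain v0 where v0: "v0 \<in> A (\<sigma> [])" using nonempty by blast
  define hist where "hist = rec_nat [v0] (\<lambda>_ h. h @ [nxt h])"
  have hist_simps: "hist 0 = [v0]" "hist (Suc t) = hist t @ [nxt (hist t)]" for t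
    by (simp_all add: hist_def)
  define r where "r t = last (hist t)" for t
  have r_simps: "r 0 = v0" "r (Suc t) = nxt (hist t)" for t
    by (simp_all add: r_def hist_simps)
  have hist: "hist t = map r [0..<Suc t]" for t
    by (induction t) (simp_all add: hist_simps r_simps)
  have cops_Suc: "cops_at \<sigma> r (Suc t) = \<sigma> (hist t)" for t
    by (simp add: cops_at_def hist)
  have ok_nxt: "ok h (nxt h)" if "\<exists>v. ok h v" for h
    using that unfolding nxt_def by (simp add: someI_ex)
  have stay: "robber_move G R C v v" if "v \<in> verts G" for C v
    unfolding robber_move_def by (rule exI[of _ "[v]"]) (use that in \<open>auto simp: vwalk_def zero_enat_def[symmetric]\<close>)
  have r_verts: "r t \<in> verts G" for t
  proof (induction t)
    case 0
    then show ?case using v0 verts by (auto simp: r_simps)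
  next
    case (Suc t)
    show ?case
    proof (cases "\<exists>v. ok (hist t) v")
      case True
      then show ?thesis using ok_nxt[OF True] verts by (auto simp: r_simps ok_def)
    next
      case False
      then have "r (Suc t) = r t" by (simp only: r_simps nxt_def if_False) (simp add: r_def)
      then show ?thesis using Suc by simp
    qed
  qed
  have play: "robber_play G R k \<sigma> r"
    unfolding robber_play_def
  proof (intro conjI allI)
    show "r 0 \<in> verts G" by (rule r_verts)
    fix t
    show "robber_move G R (cops_at \<sigma> r (Suc t) ` {..<k}) (r t) (r (Suc t))"
    proof (cases "\<exists>v. ok (hist t) v")
      case True
      then show ?thesis using ok_nxt[OF True]
        by (simp only: cops_Suc r_simps ok_def) (simp add: r_def)
    next
      case False
      then have "r (Suc t) = r t" by (simp only: r_simps nxt_def if_False) (simp add: r_def)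
      then show ?thesis using stay[OF r_verts] by simp
    qed
  qed
  have moves: "cops_move G k (cops_at \<sigma> r t) (cops_at \<sigma> r (Suc t))" for t
    using legal play unfolding legal_cop_strategy_def by blast
  \<comment> \<open>Legality along \<open>r\<close> is now available, so \<open>escape\<close>
    applies in every round and the fallback of staying put never occurs.\<close>
  have good: "r t \<in> A (cops_at \<sigma> r t)" for t
  proof (induction t)
    case 0
    then show ?case using v0 by (simp add: cops_at_def r_simps)
  next
    case (Suc t)
    have "\<exists>v. ok (hist t) v"
      using escape[OF Suc moves] by (auto simp: ok_def cops_Suc r_def)
    from ok_nxt[OF this] show ?case by (simp add: ok_def cops_Suc r_simps)
  qed
  have "\<not> caught k \<sigma> r"
    using safe[OF good moves] unfolding caught_def by blast
  with win play show False by blast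
qed

section \<open>Balls inside a vertex set\<close>

text \<open>Each new layer is cut down to \<open>A\<close>, so for \<open>v\<close> in
  \<open>A\<close> all walks behind the ball stay in \<open>A\<close>. The robber needs this, since
  he may not pass through a cop.\<close>

fun ball_in :: "'a rel \<Rightarrow> 'a set \<Rightarrow> 'a \<Rightarrow> nat \<Rightarrow> 'a set" where
  "ball_in E A v 0 = {v}"
| "ball_in E A v (Suc j) = ball_in E A v j \<union> (E `` ball_in E A v j \<inter> A)"

lemma ball_in_subset: "v \<in> A \<Longrightarrow> ball_in E A v j \<subseteq> A"
  by (induction j) auto

lemma ball_in_vwalk:
  assumes "v \<in> A" "A \<subseteq> verts G" "u \<in> ball_in (arcs_ends G) A v j"
  shows "\<exists>w. vwalk w G \<and> hd w = v \<and> last w = u \<and> vwalk_length w \<le> j \<and> set w \<subseteq> A"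
  using assms(3)
proof (induction j arbitrary: u)
  case 0
  then show ?case using assms by (intro exI[of _ "[v]"]) (auto simp: vwalk_def)
next
  case (Suc j)
  show ?case
  proof (cases "u \<in> ball_in (arcs_ends G) A v j")
    case True
    then show ?thesis using Suc.IH by (meson le_SucI)
  next
    case False
    with Suc.prems obtain z where z: "z \<in> ball_in (arcs_ends G) A v j" "(z, u) \<in> arcs_ends G" "u \<in> A"
      by auto
    from Suc.IH[OF z(1)] obtain w where w: "vwalk w G" "hd w = v" "last w = z"
      "vwalk_length w \<le> j" "set w \<subseteq> A" by blast
    then have "w \<noteq> []" by auto
    then show ?thesis using w z assms(2)
      by (intro exI[of _ "w @ [u]"]) (auto simp: vwalk_def set_vwalk_arcs_snoc)
  qed
qed

section \<open>Expansion and the robber's territory\<close>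

text \<open>The alternative \<open>u = v\<close> in \<open>joined\<close> is needed because the sets
  may overlap and permutations have fixed points, while the graph has no loops.\<close>

locale expander =
  fixes V :: "'a set" and E :: "'a rel" and x g :: nat
  assumes finite_V: "finite V"
    and E_subset: "E \<subseteq> V \<times> V"
    and joined: "\<And>X Y. X \<subseteq> V \<Longrightarrow> Y \<subseteq> V \<Longrightarrow> x \<le> card X \<Longrightarrow> card V \<le> 4 * card Y \<Longrightarrow>
      \<exists>u\<in>X. \<exists>v\<in>Y. u = v \<or> (u, v) \<in> E"
    and x_pos: "0 < x"
    and g_ge: "4 \<le> g"
    and xg_le: "4 * x * g \<le> card V"
begin

lemma x_le: "16 * x \<le> card V"
proof -
  have "4 * x * 4 \<le> 4 * x * g" using g_ge by (intro mult_le_mono) auto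
  with xg_le show ?thesis by linarith
qed

lemma finite_subset_V: "X \<subseteq> V \<Longrightarrow> finite X"
  using finite_V finite_subset by blast

lemma finite_Image: "finite (E `` X)"
  using E_subset by (intro finite_subset_V) auto

lemma card_far_less:
  assumes "X \<subseteq> V" "x \<le> card X"
  shows "4 * card (V - X - E `` X) < card V"
  using joined[of X "V - X - E `` X"] assms by (cases "card V \<le> 4 * card (V - X - E `` X)") auto

text \<open>Take \<open>W\<close> of maximal size among the sets of fewer than \<open>x\<close>
  vertices that do not expand by the factor \<open>g\<close> outside \<open>S\<close>. A
  non-expanding \<open>X\<close> could be added to it: the union is again non-expanding and has
  fewer than \<open>2 * x\<close> vertices. Since no non-expanding set has size between
  \<open>x\<close> and \<open>2 * x\<close>, the union contradicts maximality.\<close>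

lemma expanding_part:
  assumes S: "S \<subseteq> V" "8 * card S \<le> card V"
  shows "\<exists>W. W \<subseteq> V - S \<and> card W < x \<and>
    (\<forall>X. X \<subseteq> V - S - W \<longrightarrow> card X \<le> x \<longrightarrow> g * card X \<le> card (E `` X - S - W - X))"
proof -
  define bad where "bad W \<longleftrightarrow> W \<subseteq> V - S \<and> card (E `` W - S - W) \<le> g * card W" for W
  \<comment> \<open>Otherwise \<open>V\<close> is covered by the vertices far from \<open>W\<close>
    (less than 1/4 of \<open>V\<close>), the boundary of \<open>W\<close> (at most 1/2),
    \<open>S\<close> (at most 1/8) and \<open>W\<close> (at most 1/8), which is too little.\<close>
  have small: "card W < x" if "bad W" "card W \<le> 2 * x" for W
  proof (rule ccontr)
    assume "\<not> card W < x"
    have W: "W \<subseteq> V" using that by (auto simp: bad_def)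
    have "card V \<le> card ((V - W - E `` W) \<union> (E `` W - S - W) \<union> S \<union> W)"
      using S finite_V W by (intro card_mono) (auto intro: finite_subset_V simp: finite_Image)
    also have "\<dots> \<le> card (V - W - E `` W) + card (E `` W - S - W) + card S + card W"
      by (meson add_le_mono card_Un_le le_refl order_trans)
    finally have "card V \<le> \<dots>" .
    moreover have "4 * card (V - W - E `` W) < card V"
      using card_far_less W \<open>\<not> card W < x\<close> by simp
    moreover have "card (E `` W - S - W) \<le> g * (2 * x)"
      using that unfolding bad_def by (meson le_trans mult_le_mono2)
    moreover have "g * (2 * x) * 2 \<le> card V" using xg_le by (simp add: mult.commute mult.left_commute)
    ultimately show False using S(2) that(2) x_le by linarith
  qed
  define F where "F = {W. bad W \<and> card W < x}"
  have "F \<subseteq> Pow V" by (auto simp: F_def bad_def)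
  then have "finite F" using finite_V by (meson finite_Pow_iff finite_subset)
  moreover have "{} \<in> F" using x_pos by (simp add: F_def bad_def)
  ultimately have "Max (card ` F) \<in> card ` F" by (intro Max_in) auto
  then obtain W where W: "W \<in> F" "card W = Max (card ` F)" by auto
  have max: "card W' \<le> card W" if "W' \<in> F" for W'
    using that \<open>finite F\<close> W(2) by simp
  have "g * card X \<le> card (E `` X - S - W - X)" if X: "X \<subseteq> V - S - W" "card X \<le> x" for X
  proof (rule ccontr)
    assume *: "\<not> ?thesis"
    then have "card X \<noteq> 0" by (intro notI) simp
    have bW: "bad W" "card W < x" using W(1) by (auto simp: F_def)
    have fin: "finite W" "finite X" using bW X finite_subset_V by (auto simp: bad_def)
    have card: "card (W \<union> X) = card W + card X"
      using fin X by (intro card_Un_disjoint) auto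
    have "card (E `` (W \<union> X) - S - (W \<union> X)) \<le> card ((E `` W - S - W) \<union> (E `` X - S - W - X))"
      by (intro card_mono) (auto simp: finite_Image)
    also have "\<dots> \<le> card (E `` W - S - W) + card (E `` X - S - W - X)" by (rule card_Un_le)
    also have "\<dots> \<le> g * card W + g * card X" using bW * by (auto simp: bad_def)
    also have "\<dots> = g * card (W \<union> X)" using card by (simp add: algebra_simps)
    finally have "bad (W \<union> X)" using bW X by (auto simp: bad_def)
    then have "W \<union> X \<in> F" using small[of "W \<union> X"] card bW X(2) by (auto simp: F_def)
    from max[OF this] card \<open>card X \<noteq> 0\<close> show False by simp
  qed
  then show ?thesis using W(1) by (intro exI[of _ W]) (auto simp: F_def bad_def)
qed

lemma robber_territory:
  assumes S: "S \<subseteq> V" "8 * card S \<le> card V" and r: "x \<le> g ^ r"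
  shows "\<exists>A \<subseteq> V - S. card V < 2 * card A \<and> (\<forall>v\<in>A. card V < 2 * card (ball_in E A v (Suc r)))"
proof -
  from expanding_part[OF S] obtain W where W: "W \<subseteq> V - S" "card W < x"
    and grow: "\<And>X. X \<subseteq> V - S - W \<Longrightarrow> card X \<le> x \<Longrightarrow> g * card X \<le> card (E `` X - S - W - X)"
    by blast
  define A where "A = V - S - W"
  have fin: "finite S" "finite W" "finite A"
    by (rule finite_subset_V; use S W in \<open>auto simp: A_def\<close>)+
  have "card V \<le> card (S \<union> W \<union> A)"
    using fin by (intro card_mono) (auto simp: A_def)
  also have "\<dots> \<le> card S + card W + card A"
    by (meson add_le_mono card_Un_le le_refl order_trans)
  finally have A: "card V < 2 * card A" using S(2) W(2) x_le by linarith
  have "card V < 2 * card (ball_in E A v (Suc r))" if v: "v \<in> A" for v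
  proof -
    have sub: "ball_in E A v j \<subseteq> A" for j using v by (rule ball_in_subset)
    have finb: "finite (ball_in E A v j)" for j using sub fin finite_subset by blast
    \<comment> \<open>Expansion is known only for sets of at most \<open>x\<close> vertices, so
      growth is claimed only up to \<open>x\<close>.\<close>
    have "min x (g ^ j) \<le> card (ball_in E A v j)" for j
    proof (induction j)
      case 0
      then show ?case by simp
    next
      case (Suc j)
      let ?B = "ball_in E A v j"
      have mono: "card ?B \<le> card (ball_in E A v (Suc j))"
        by (intro card_mono finb) auto
      show ?case
      proof (cases "x \<le> card ?B")
        case True
        then show ?thesis using mono by simp
      next
        case False
        then have "g ^ j \<le> card ?B" using Suc by linarith
        then have "g * g ^ j \<le> g * card ?B" by simp
        also have "\<dots> \<le> card (E `` ?B - S - W - ?B)"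
          using sub[of j] False by (intro grow) (auto simp: A_def)
        also have "\<dots> \<le> card (ball_in E A v (Suc j))"
          using E_subset by (intro card_mono finb) (auto simp: A_def)
        finally show ?thesis by simp
      qed
    qed
    from this[of r] r have "x \<le> card (ball_in E A v r)" by simp
    moreover have "ball_in E A v r \<subseteq> V" using sub[of r] by (auto simp: A_def)
    ultimately have far: "4 * card (V - ball_in E A v r - E `` ball_in E A v r) < card V"
      by (intro card_far_less)
    \<comment> \<open>One further step from \<open>x\<close> vertices misses less than 1/4 of
      \<open>V\<close>, apart from \<open>S\<close> and \<open>W\<close>, which take at most 1/8 and
      less than 1/16. More than half of \<open>V\<close> remains.\<close>
    have "card V \<le> card ((V - ball_in E A v r - E `` ball_in E A v r) \<union> S \<union> W \<union> ball_in E A v (Suc r))"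
      using fin finite_V finb[of "Suc r"] by (intro card_mono) (auto simp: A_def)
    also have "\<dots> \<le> card (V - ball_in E A v r - E `` ball_in E A v r) + card S + card W
        + card (ball_in E A v (Suc r))"
      by (meson add_le_mono card_Un_le le_refl order_trans)
    finally show ?thesis using far S(2) W(2) x_le by linarith
  qed
  with A show ?thesis by (intro exI[of _ A]) (auto simp: A_def)
qed

text \<open>The ball around the robber and the territory of the new cop position each hold more than
  half of \<open>V\<close>, so they meet. The walk between stays in the old territory, which the
  moved cops cannot have entered.\<close>

lemma not_cops_win:
  fixes G :: "('a, 'b) pre_digraph"
  assumes G: "verts G = V" "arcs_ends G = E"
    and deg: "\<And>v. card (E `` {v}) \<le> d" and k: "8 * k * Suc d \<le> card V"
    and r: "x \<le> g ^ r" "enat (Suc r) \<le> R"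
  shows "\<not> cops_win G R k"
proof -
  \<comment> \<open>A position \<open>c\<close> is an arbitrary function here and may take values
    outside \<open>V\<close>, hence the intersection.\<close>
  define S where "S c = V \<inter> (\<Union>i<k. insert (c i) (E `` {c i}))" for c :: "nat \<Rightarrow> 'a"
  have "card (S c) \<le> k * Suc d" for c
  proof -
    have "card (S c) \<le> card (\<Union>i<k. insert (c i) (E `` {c i}))"
      unfolding S_def by (intro card_mono) (auto simp: finite_Image)
    also have "\<dots> \<le> (\<Sum>i<k. card (insert (c i) (E `` {c i})))" by (intro card_UN_le) auto
    also have "\<dots> \<le> (\<Sum>i<k. Suc d)"
      using deg by (intro sum_mono) (simp add: card_insert_if finite_Image le_SucI)
    finally show ?thesis by simp
  qed
  then have "8 * card (S c) \<le> 8 * (k * Suc d)" for c by (intro mult_le_mono2)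
  then have S: "S c \<subseteq> V" "8 * card (S c) \<le> card V" for c
    using k order_trans by (auto simp only: S_def mult.assoc Int_lower1)
  from robber_territory[OF S r(1)] obtain A where A: "\<And>c. A c \<subseteq> V - S c"
    "\<And>c. card V < 2 * card (A c)" "\<And>c v. v \<in> A c \<Longrightarrow> card V < 2 * card (ball_in E (A c) v (Suc r))"
    by metis
  have avoid: "c' i \<notin> A c" if "cops_move G k c c'" "i < k" for c c' i
  proof
    assume "c' i \<in> A c"
    then have "c' i \<in> V" "c' i \<notin> S c" using A(1) by auto
    then show False using that unfolding cops_move_def S_def G by auto
  qed
  show ?thesis
  proof (rule not_cops_winI[of A])
    fix c
    show "A c \<noteq> {}" using A(2)[of c] by auto
    show "A c \<subseteq> verts G" using A(1) G by auto
  next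
    fix c c' v i
    assume "v \<in> A c" "cops_move G k c c'" "i < k"
    then show "c' i \<noteq> v" using avoid by blast
  next
    fix c c' v
    assume v: "v \<in> A c" and move: "cops_move G k c c'"
    let ?B = "ball_in E (A c) v (Suc r)"
    have B: "?B \<subseteq> A c" using v by (rule ball_in_subset)
    have "?B \<inter> A c' \<noteq> {}"
    proof
      assume "?B \<inter> A c' = {}"
      then have "card ?B + card (A c') = card (?B \<union> A c')"
        using A(1) B by (intro card_Un_disjoint[symmetric] finite_subset_V) auto
      also have "\<dots> \<le> card V" using A(1)[of c'] A(1)[of c] B by (intro card_mono finite_V) blast
      finally show False using A(2)[of c'] A(3)[OF v] by linarith
    qed
    then obtain u where u: "u \<in> ?B" "u \<in> A c'" by blast
    have "A c \<subseteq> verts G" using A(1) G by auto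
    from ball_in_vwalk[OF v this, of u "Suc r"] u(1) obtain w where w: "vwalk w G" "hd w = v"
      "last w = u" "vwalk_length w \<le> Suc r" "set w \<subseteq> A c" unfolding G by blast
    have "set (tl w) \<subseteq> A c" using w(5) by (cases w) auto
    then have "set (tl w) \<inter> c' ` {..<k} = {}" using avoid[OF move] by auto
    moreover have "enat (vwalk_length w) \<le> R"
      using w(4) r(2) by (meson enat_ord_simps(1) order_trans)
    ultimately have "robber_move G R (c' ` {..<k}) v u"
      using w unfolding robber_move_def by blast
    with u(2) show "\<exists>v'\<in>A c'. robber_move G R (c' ` {..<k}) v v'" by blast
  qed
qed

end

section \<open>Counting random permutations\<close>

text \<open>A random permutation of \<open>N\<close> maps \<open>X\<close> off \<open>Y\<close> with
  probability at most \<open>(1 - card Y / card N) ^ card X\<close>, stated without division. Each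
  element added to \<open>X\<close> contributes one factor.\<close>

lemma card_permutes_avoiding:
  assumes N: "finite N" and X: "X \<subseteq> N" and Y: "Y \<subseteq> N"
  shows "card {p. p permutes N \<and> p ` X \<inter> Y = {}} * card N ^ card X
    \<le> (card N - card Y) ^ card X * fact (card N)"
proof -
  have "finite X" using N X finite_subset by blast
  then show ?thesis using X
  proof (induction X rule: finite_induct)
    case empty
    then show ?case using card_permutations[OF refl N] by simp
  next
    case (insert z X)
    define P where "P X = {p. p permutes N \<and> p ` X \<inter> Y = {}}" for X :: "'a set"
    have finP: "finite (P X)" for X
      by (rule finite_subset[OF _ finite_permutations[OF N]]) (auto simp: P_def)
    have "finite Y" using N Y finite_subset by blast
    let ?Q = "P (insert z X)"
    have sub: "?Q \<subseteq> P X" by (auto simp: P_def)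
    \<comment> \<open>Exchanging the value at \<open>z\<close> with a value in \<open>Y\<close> compares the permutations that do and do
      not send \<open>z\<close> into \<open>Y\<close>.\<close>
    define \<Phi> :: "('a \<Rightarrow> 'a) \<times> 'a \<Rightarrow> ('a \<Rightarrow> 'a) \<times> 'a" where "\<Phi> = (\<lambda>(p, w). (transpose w (p z) \<circ> p, p z))"
    have "inj_on \<Phi> (?Q \<times> Y)"
    proof (rule inj_onI, clarify)
      fix p w p' w'
      assume "\<Phi> (p, w) = \<Phi> (p', w')"
      then have eq: "transpose w (p z) \<circ> p = transpose w' (p' z) \<circ> p'" "p z = p' z"
        by (auto simp: \<Phi>_def)
      have "w = w'" using fun_cong[OF eq(1), of z] by (simp add: transpose_apply_second)
      have "transpose w (p z) \<circ> (transpose w (p z) \<circ> p) = transpose w (p z) \<circ> (transpose w (p z) \<circ> p')"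
        using eq \<open>w = w'\<close> by simp
      then have "p = p'" by (simp add: o_assoc)
      with \<open>w = w'\<close> show "p = p' \<and> w = w'" by simp
    qed
    moreover have "\<Phi> ` (?Q \<times> Y) \<subseteq> (P X - ?Q) \<times> (N - Y)"
    proof clarify
      fix p w q u assume p: "p \<in> ?Q" and w: "w \<in> Y" and eq: "(q, u) = \<Phi> (p, w)"
      have perm: "p permutes N" using p by (simp add: P_def)
      have zN: "z \<in> N" using insert.prems by simp
      have pz: "p z \<in> N" "p z \<notin> Y" using p zN permutes_in_image[OF perm] by (auto simp: P_def)
      have q: "q = transpose w (p z) \<circ> p" "u = p z" using eq by (auto simp: \<Phi>_def)
      have "q permutes N" unfolding q using perm pz(1) w Y
        by (intro permutes_compose permutes_swap_id) auto
      \<comment> \<open>The transposition affects only the values \<open>w\<close> and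
        \<open>p z\<close>. On \<open>X\<close>, \<open>p\<close> avoids the first because
        \<open>w\<close> lies in \<open>Y\<close>, and the second by injectivity.\<close>
      moreover have "q a = p a" if "a \<in> X" for a
      proof -
        have "p a \<noteq> w" using that p w by (auto simp: P_def)
        moreover have "p a \<noteq> p z" using that insert.hyps permutes_inj[OF perm] by (auto dest: injD)
        ultimately show ?thesis by (simp add: q transpose_apply_other)
      qed
      ultimately have "q \<in> P X" using p by (auto simp: P_def)
      moreover have "q z \<in> Y" using w by (simp add: q transpose_apply_second)
      then have "q \<notin> ?Q" by (auto simp: P_def)
      ultimately show "q \<in> P X - ?Q \<and> u \<in> N - Y" using pz q(2) by auto
    qed
    ultimately have "card (?Q \<times> Y) \<le> card ((P X - ?Q) \<times> (N - Y))"
      using finP N by (intro card_inj_on_le) auto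
    then have "card ?Q * card Y \<le> (card (P X) - card ?Q) * (card N - card Y)"
      using sub finP \<open>finite Y\<close> Y by (simp add: card_cartesian_product card_Diff_subset)
    \<comment> \<open>Replacing the truncated differences by \<open>a\<close> and \<open>b\<close>
      reduces the claim to adding the same product to both sides.\<close>
    moreover obtain a where "card (P X) = card ?Q + a"
      using card_mono[OF finP sub] le_iff_add by blast
    moreover obtain b where "card N = card Y + b"
      using card_mono[OF N Y] le_iff_add by blast
    ultimately have step: "card ?Q * card N \<le> card (P X) * (card N - card Y)"
      by (simp add: algebra_simps)
    have "card ?Q * card N ^ card (insert z X) = card ?Q * card N * card N ^ card X"
      using insert.hyps by simp
    also have "\<dots> \<le> card (P X) * (card N - card Y) * card N ^ card X"
      using step by (intro mult_le_mono1)
    also have "\<dots> = (card N - card Y) * (card (P X) * card N ^ card X)" by simp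
    also have "\<dots> \<le> (card N - card Y) * ((card N - card Y) ^ card X * fact (card N))"
      using insert.IH insert.prems by (intro mult_le_mono2) (auto simp: P_def)
    also have "\<dots> = (card N - card Y) ^ card (insert z X) * fact (card N)"
      using insert.hyps by simp
    finally show ?case by (simp add: P_def)
  qed
qed

text \<open>Union bound: there are at most \<open>4 ^ n\<close> pairs of sets, and for each of them
  all \<open>D\<close> independent permutations fail with probability at most
  \<open>(3/4) ^ (x * D)\<close>.\<close>

lemma exists_joining_permutations:
  assumes N: "finite N" "N \<noteq> {}" and D: "5 * card N \<le> x * D"
  shows "\<exists>p :: nat \<Rightarrow> 'a \<Rightarrow> 'a. (\<forall>i<D. p i permutes N) \<and>
    (\<forall>X Y. X \<subseteq> N \<longrightarrow> Y \<subseteq> N \<longrightarrow> x \<le> card X \<longrightarrow> card N \<le> 4 * card Y \<longrightarrow>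
      (\<exists>i<D. p i ` X \<inter> Y \<noteq> {}))"
proof (rule ccontr)
  assume neg: "\<not> ?thesis"
  define n where "n = card N"
  have n: "0 < n" using N by (simp add: n_def card_gt_0_iff)
  define B where "B X Y = {p. p permutes N \<and> p ` X \<inter> Y = {}}" for X Y
  define Z where "Z = {(X, Y). X \<subseteq> N \<and> Y \<subseteq> N \<and> x \<le> card X \<and> n \<le> 4 * card Y}"
  define T where "T X Y = ({..<D} \<rightarrow>\<^sub>E B X Y)" for X Y
  have finB: "finite (B X Y)" for X Y
    by (rule finite_subset[OF _ finite_permutations[OF N(1)]]) (auto simp: B_def)
  have Z_sub: "Z \<subseteq> Pow N \<times> Pow N" by (auto simp: Z_def)
  then have finZ: "finite Z" by (rule finite_subset) (use N in auto)
  have "card Z \<le> card (Pow N \<times> Pow N)" using Z_sub N by (intro card_mono) auto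
  also have "\<dots> = 4 ^ n"
    using N by (simp add: card_cartesian_product card_Pow n_def flip: power_mult_distrib)
  finally have cardZ: "card Z \<le> 4 ^ n" .
  have cardB: "real (card (B X Y)) \<le> (3/4) ^ x * fact n" if "(X, Y) \<in> Z" for X Y
  proof -
    have XY: "X \<subseteq> N" "Y \<subseteq> N" "x \<le> card X" "n \<le> 4 * card Y" using that by (auto simp: Z_def)
    have "card Y \<le> n" using XY N by (auto simp: n_def intro: card_mono)
    have "real (card (B X Y) * n ^ card X) \<le> real ((n - card Y) ^ card X * fact n)"
      using card_permutes_avoiding[OF N(1) XY(1,2)] unfolding B_def n_def by (rule of_nat_mono)
    then have "real (card (B X Y)) * real n ^ card X \<le> real (n - card Y) ^ card X * fact n" by simp
    also have "\<dots> \<le> (3/4 * real n) ^ card X * fact n"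
      using XY(4) \<open>card Y \<le> n\<close> by (intro mult_right_mono power_mono) (auto simp: of_nat_diff)
    finally have "real (card (B X Y)) * real n ^ card X \<le> ((3/4) ^ card X * fact n) * real n ^ card X"
      by (simp only: power_mult_distrib mult_ac)
    then have "real (card (B X Y)) \<le> (3/4) ^ card X * fact n"
      using n by (simp add: mult_le_cancel_right)
    also have "\<dots> \<le> (3/4) ^ x * fact n"
      using XY(3) by (intro mult_right_mono power_decreasing) auto
    finally show ?thesis .
  qed
  have cover: "({..<D} \<rightarrow>\<^sub>E {p. p permutes N}) \<subseteq> (\<Union>(X, Y)\<in>Z. T X Y)"
  proof
    fix p assume p: "p \<in> ({..<D} \<rightarrow>\<^sub>E {p. p permutes N})"
    then have perm: "\<forall>i<D. p i permutes N" by auto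
    have "\<not> (\<forall>X Y. X \<subseteq> N \<longrightarrow> Y \<subseteq> N \<longrightarrow> x \<le> card X \<longrightarrow> card N \<le> 4 * card Y \<longrightarrow>
      (\<exists>i<D. p i ` X \<inter> Y \<noteq> {}))"
      by (rule notI, rule notE[OF neg], intro exI[of _ p] conjI perm)
    then obtain X Y where "X \<subseteq> N" "Y \<subseteq> N" "x \<le> card X" "card N \<le> 4 * card Y"
      "\<forall>i<D. p i ` X \<inter> Y = {}" by meson
    then have "(X, Y) \<in> Z" "p \<in> T X Y"
      using p by (auto simp: Z_def T_def B_def n_def PiE_iff)
    then show "p \<in> (\<Union>(X, Y)\<in>Z. T X Y)" by blast
  qed
  have "fact n ^ D = card ({..<D} \<rightarrow>\<^sub>E {p. p permutes N})"
    using card_permutations[OF refl N(1)] by (simp add: card_PiE n_def)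
  also have "\<dots> \<le> card (\<Union>(X, Y)\<in>Z. T X Y)"
    using cover finZ finB by (intro card_mono) (auto simp: T_def intro!: finite_PiE)
  also have "\<dots> \<le> (\<Sum>z\<in>Z. card (case z of (X, Y) \<Rightarrow> T X Y))"
    using finZ by (rule card_UN_le)
  finally have "real (fact n ^ D) \<le> real (\<Sum>z\<in>Z. card (case z of (X, Y) \<Rightarrow> T X Y))"
    by (rule of_nat_mono)
  also have "\<dots> = (\<Sum>z\<in>Z. real (card (case z of (X, Y) \<Rightarrow> T X Y)))" by simp
  also have "\<dots> \<le> (\<Sum>z\<in>Z. ((3/4) ^ x * fact n) ^ D)"
  proof (rule sum_mono, clarify)
    fix X Y assume "(X, Y) \<in> Z"
    then show "real (card (T X Y)) \<le> ((3/4) ^ x * fact n) ^ D"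
      using cardB by (simp add: T_def card_PiE power_mono)
  qed
  also have "\<dots> = real (card Z) * ((3/4) ^ (x * D) * fact n ^ D)"
    by (simp add: power_mult_distrib power_mult)
  also have "\<dots> \<le> 4 ^ n * ((3/4) ^ (5 * n) * fact n ^ D)"
  proof (intro mult_mono)
    show "real (card Z) \<le> 4 ^ n" using of_nat_mono[OF cardZ, where 'a = real] by simp
    show "((3/4) :: real) ^ (x * D) \<le> (3/4) ^ (5 * n)"
      using D by (intro power_decreasing) (auto simp: n_def)
  qed auto
  also have "\<dots> = (4 * (3/4) ^ 5) ^ n * fact n ^ D"
    by (simp only: power_mult power_mult_distrib mult.assoc)
  finally have "1 \<le> ((4 * (3/4) ^ 5) :: real) ^ n" by (simp add: field_simps)
  \<comment> \<open>The factor 5 in the bound on \<open>x * D\<close> is the least exponent that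
    brings this base below 1.\<close>
  moreover have "(4 * (3/4) ^ 5 :: real) = 243/256" by (simp add: power_divide)
  moreover have "(243/256 :: real) ^ n < 1" using n by (simp add: power_less_one_iff)
  ultimately show False by simp
qed

section \<open>Construction of the graph\<close>

lemma exists_fast_robber_graph:
  fixes n g :: nat
  assumes g: "4 \<le> g" and n: "24 * g \<le> n"
  shows "\<exists>G :: (nat, nat \<times> nat) pre_digraph.
    graph G \<and> Digraph_Component.connected G \<and> card (verts G) = n \<and>
    (\<forall>k r R. n div (4 * g) \<le> g ^ r \<longrightarrow> enat (Suc r) \<le> R \<longrightarrow> 8 * k * (48 * g + 3) \<le> n \<longrightarrow>
      \<not> cops_win G R k)"
proof -
  define D where "D = 24 * g"
  define x where "x = n div (4 * g)"
  have n_pos: "0 < n" using g n by linarith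
  \<comment> \<open>Rounding loses less than \<open>4 * g\<close>, at most a sixth of
    \<open>n\<close>, so \<open>x * D\<close> is 6 times a number of at least
    \<open>5 * n / 6\<close>.\<close>
  have "4 * g * x + n mod (4 * g) = n" unfolding x_def by (rule mult_div_mod_eq)
  moreover have "n mod (4 * g) < 4 * g" using g by simp
  moreover have "x * D = 6 * (4 * g * x)" by (simp add: D_def)
  ultimately have x: "5 * n \<le> x * D" "4 * x * g \<le> n" using n by (linarith, simp add: mult_ac)
  have "0 < x" using x(1) n_pos by (cases x) auto
  obtain p :: "nat \<Rightarrow> nat \<Rightarrow> nat" where perm: "\<And>i. i < D \<Longrightarrow> p i permutes {..<n}"
    and joining: "\<And>X Y. X \<subseteq> {..<n} \<Longrightarrow> Y \<subseteq> {..<n} \<Longrightarrow> x \<le> card X \<Longrightarrow> n \<le> 4 * card Y \<Longrightarrow>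
      \<exists>i<D. p i ` X \<inter> Y \<noteq> {}"
    using exists_joining_permutations[of "{..<n}" x D] x(1) n_pos
    unfolding card_lessThan lessThan_empty_iff bot_nat_def by blast
  \<comment> \<open>The path edges serve only connectedness; \<open>u \<noteq> v\<close> discards
    the loops at fixed points.\<close>
  define E where "E = {(u, v). u < n \<and> v < n \<and> u \<noteq> v \<and>
    (v = Suc u \<or> u = Suc v \<or> (\<exists>i<D. p i u = v \<or> p i v = u))}"
  define G :: "(nat, nat \<times> nat) pre_digraph" where
    "G = \<lparr>verts = {..<n}, arcs = E, tail = fst, head = snd\<rparr>"
  have G: "verts G = {..<n}" "arcs_ends G = E"
    by (auto simp: G_def arcs_ends_conv)
  have E_sub: "E \<subseteq> {..<n} \<times> {..<n}" by (auto simp: E_def)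
  then have "finite E" by (rule finite_subset) simp
  have "sym E" unfolding E_def sym_def by blast
  interpret graph G
  proof
    show "symmetric G" using \<open>sym E\<close> by (simp add: symmetric_def G)
  qed (use \<open>finite E\<close> in \<open>auto simp: G_def E_def arc_to_ends_def\<close>)
  have "0 \<rightarrow>\<^sup>*\<^bsub>G\<^esub> v" if "v < n" for v
    using that
  proof (induction v)
    case 0
    then show ?case by (simp add: G)
  next
    case (Suc v)
    then have "v \<rightarrow>\<^bsub>G\<^esub> Suc v" by (simp add: G E_def)
    with Suc show ?case using reachable_adj_trans by simp
  qed
  then have reach: "u \<rightarrow>\<^sup>*\<^bsub>G\<^esub> v" if "u < n" "v < n" for u v
    using that symmetric_reachable' reachable_trans by blast
  have "verts (mk_symmetric G) = {..<n}" by (simp add: G)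
  then have conn: "Digraph_Component.connected G"
    unfolding connected_def strongly_connected_def
    using n_pos reach reachable_mk_symmetricI by auto
  have expander: "expander {..<n} E x g"
  proof
    fix X Y assume XY: "X \<subseteq> {..<n}" "Y \<subseteq> {..<n}" "x \<le> card X" "card {..<n} \<le> 4 * card Y"
    then obtain i u where "i < D" "u \<in> X" "p i u \<in> Y" using joining[of X Y] by auto
    moreover have "u < n" "p i u < n" using XY(1,2) \<open>u \<in> X\<close> \<open>p i u \<in> Y\<close> by auto
    ultimately have "u = p i u \<or> (u, p i u) \<in> E" unfolding E_def by auto
    then show "\<exists>u\<in>X. \<exists>v\<in>Y. u = v \<or> (u, v) \<in> E" using \<open>u \<in> X\<close> \<open>p i u \<in> Y\<close> by blast
  qed (use x g \<open>0 < x\<close> E_sub in auto)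
  have deg: "card (E `` {v}) \<le> 48 * g + 2" for v
  proof -
    \<comment> \<open>Two path neighbours, and an image and a preimage under each of the
      \<open>24 * g\<close> permutations. At \<open>v = 0\<close> the truncated \<open>v - 1\<close>
      merely enlarges the covering set.\<close>
    have "E `` {v} \<subseteq> {Suc v, v - 1} \<union> (\<lambda>i. p i v) ` {..<D} \<union> (\<lambda>i. inv (p i) v) ` {..<D}"
    proof
      fix u assume "u \<in> E `` {v}"
      then consider "u \<in> {Suc v, v - 1}" | i where "i < D" "p i v = u" | i where "i < D" "p i u = v"
        unfolding E_def by auto
      then show "u \<in> {Suc v, v - 1} \<union> (\<lambda>i. p i v) ` {..<D} \<union> (\<lambda>i. inv (p i) v) ` {..<D}"
      proof cases
        case (3 i)
        then have "inv (p i) v = u" using permutes_inv_eq[OF perm] by blast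
        with 3(1) show ?thesis by (intro UnI2 image_eqI[of _ _ i]) auto
      qed auto
    qed
    then have "card (E `` {v})
        \<le> card ({Suc v, v - 1} \<union> (\<lambda>i. p i v) ` {..<D} \<union> (\<lambda>i. inv (p i) v) ` {..<D})"
      by (intro card_mono) auto
    also have "\<dots> \<le> card {Suc v, v - 1} + card ((\<lambda>i. p i v) ` {..<D})
        + card ((\<lambda>i. inv (p i) v) ` {..<D})"
      by (meson add_le_mono card_Un_le le_refl order_trans)
    also have "\<dots> \<le> 2 + D + D"
      using card_image_le[of "{..<D}" "\<lambda>i. p i v"] card_image_le[of "{..<D}" "\<lambda>i. inv (p i) v"]
      by (intro add_le_mono) (auto simp: card_insert_if)
    finally show ?thesis by (simp add: D_def)
  qed
  have "\<not> cops_win G R k" if "x \<le> g ^ r" "enat (Suc r) \<le> R" "8 * k * (48 * g + 3) \<le> n" for k r R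
    using expander.not_cops_win[OF expander G deg _ that(1,2)] that(3)
    by (simp add: algebra_simps)
  then show ?thesis using conn G graph_axioms unfolding x_def by auto
qed

section \<open>Asymptotics and the choice of parameters\<close>

text \<open>Here \<open>a\<close> is the exponent of \<open>g\<close> and \<open>1 - b\<close> that
  of the number of cops. The second left-hand side has order \<open>n powr (1 - b + a)\<close>, with
  exponent below 1 because \<open>a < b\<close>.\<close>

lemma eventually_degree_bounds:
  fixes a b :: real
  assumes "0 < a" "a < b" "b \<le> 1"
  shows "\<forall>\<^sub>F n :: nat in sequentially. 24 * (real n powr a + 5) \<le> real n"
    and "\<forall>\<^sub>F n :: nat in sequentially. 8 * real n powr (1 - b) * (48 * (real n powr a + 5) + 3) \<le> real n"
proof -
  have "a < 1" using assms by simp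
  then show "\<forall>\<^sub>F n :: nat in sequentially. 24 * (real n powr a + 5) \<le> real n"
    using assms by real_asymp
  show "\<forall>\<^sub>F n :: nat in sequentially. 8 * real n powr (1 - b) * (48 * (real n powr a + 5) + 3) \<le> real n"
    using assms by real_asymp
qed

theorem theorem1p4:
  fixes R :: enat
  assumes "R > 2"
  shows "\<forall>\<^sub>F n :: nat in sequentially.
    (R < \<infinity> \<longrightarrow>
      (\<exists>G :: (nat, nat \<times> nat) pre_digraph.
         graph G \<and> Digraph_Component.connected G \<and> card (verts G) = n \<and>
         at_least_cops_required G R (real n powr (1 - 1 / (real (the_enat R) - 2))))) \<and>
    (R = \<infinity> \<longrightarrow>
      (\<exists>G :: (nat, nat \<times> nat) pre_digraph.
         graph G \<and> Digraph_Component.connected G \<and> card (verts G) = n \<and>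
         at_least_cops_required G R (real n / 800 ^ 2)))"
proof (cases R)
  case (enat m)
  with assms have m: "3 \<le> m" by (simp add: numeral_eq_enat)
  \<comment> \<open>This exponent makes \<open>g ^ (m - 1)\<close> at least \<open>n\<close>, so
    \<open>r = m - 1\<close> works and the radius \<open>Suc r\<close> is exactly the speed
    \<open>m\<close>.\<close>
  define a where "a = 1 / (real m - 1)"
  define b where "b = 1 / (real m - 2)"
  have ab: "0 < a" "a < b" "b \<le> 1" using m by (auto simp: a_def b_def field_simps)
  show ?thesis
    using eventually_degree_bounds[OF ab] eventually_gt_at_top[of 0]
  proof eventually_elim
    case (elim n)
    \<comment> \<open>Adding 4 ensures \<open>4 \<le> g\<close>; with the rounding, \<open>g\<close>
      exceeds the power by at most 5.\<close>
    define g where "g = nat \<lceil>real n powr a\<rceil> + 4"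
    have g: "real n powr a \<le> real g" "real g \<le> real n powr a + 5"
      unfolding g_def by (simp_all add: of_nat_nat ceiling_mono, linarith+)
    have "real (24 * g) \<le> real n" using g(2) elim(1) by simp
    then have "24 * g \<le> n" by (simp only: of_nat_le_iff)
    then obtain G :: "(nat, nat \<times> nat) pre_digraph" where G: "graph G" "Digraph_Component.connected G"
      "card (verts G) = n" and evade: "\<And>k r R. n div (4 * g) \<le> g ^ r \<Longrightarrow> enat (Suc r) \<le> R \<Longrightarrow>
        8 * k * (48 * g + 3) \<le> n \<Longrightarrow> \<not> cops_win G R k"
      using exists_fast_robber_graph[of g n] by (auto simp: g_def)
    have "real n = (real n powr a) ^ (m - 1)"
      using elim(3) m by (simp add: a_def powr_power of_nat_diff)
    also have "\<dots> \<le> real g ^ (m - 1)" using g(1) by (intro power_mono) auto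
    finally have "n \<le> g ^ (m - 1)" by (simp flip: of_nat_power)
    then have *: "n div (4 * g) \<le> g ^ (m - 1)" using div_le_dividend order_trans by blast
    have "at_least_cops_required G R (real n powr (1 - b))"
      unfolding at_least_cops_required_def
    proof (intro allI impI)
      fix k assume "real k < real n powr (1 - b)"
      then have "8 * real k * (48 * real g + 3) \<le> 8 * real n powr (1 - b) * (48 * (real n powr a + 5) + 3)"
        using g(2) by (intro mult_mono) auto
      also have "\<dots> \<le> real n" by (rule elim(2))
      finally have "real (8 * k * (48 * g + 3)) \<le> real n" by simp
      then have "8 * k * (48 * g + 3) \<le> n" by (simp only: of_nat_le_iff)
      with * show "\<not> cops_win G R k" using m enat by (intro evade) auto
    qed
    with G show ?case using enat by (auto simp: b_def)
  qed
next
  case infinity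
  show ?thesis
    \<comment> \<open>Any radius is allowed here, so \<open>g = 4\<close> suffices, and 96 is
      \<open>24 * g\<close>. The condition on \<open>k\<close> reads
      \<open>1560 * k \<le> n\<close>, far weaker than the bound with
      \<open>800 ^ 2\<close>.\<close>
    using eventually_ge_at_top[of 96]
  proof eventually_elim
    case (elim n)
    then obtain G :: "(nat, nat \<times> nat) pre_digraph" where G: "graph G" "Digraph_Component.connected G"
      "card (verts G) = n" and evade: "\<And>k r R. n div (4 * 4) \<le> 4 ^ r \<Longrightarrow> enat (Suc r) \<le> R \<Longrightarrow>
        8 * k * (48 * 4 + 3) \<le> n \<Longrightarrow> \<not> cops_win G R k"
      using exists_fast_robber_graph[of 4 n] by auto
    have "n \<le> 4 ^ n" by (rule order.trans[OF less_imp_le[OF less_exp] power_mono]) auto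
    then have *: "n div (4 * 4) \<le> 4 ^ n" using div_le_dividend order_trans by blast
    have "at_least_cops_required G R (real n / 800 ^ 2)"
      unfolding at_least_cops_required_def
    proof (intro allI impI)
      fix k assume "real k < real n / 800 ^ 2"
      then have "8 * k * (48 * 4 + 3) \<le> n" by simp
      with * show "\<not> cops_win G R k" using infinity by (intro evade) auto
    qed
    with G show ?case using infinity by auto
  qed
qed

end
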